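(* Let $(E,sim,ser)$ be a comtrace alphabet. A step sequence $u\in\mathbb{S}^*$ is in GMC-form if and only if it is canonical.
   Context: A comtrace alphabet is $(E,sim,ser)$ with $E$ finite, $sim\subseteq E\times E$ irreflexive and symmetric, $ser\subseteq sim$. Steps $\mathbb{S}$: nonempty $A\subseteq E$ with $(a,b)\in sim$ for all distinct $a,b\in A$. The comtrace congruence $\equiv$ on $\mathbb{S}^*$ is the reflexive symmetric transitive closure of the pairs $(wAz,wBCz)$ with $w,z\in\mathbb{S}^*$, $A,B,C\in\mathbb{S}$, $A=B\cup C$, $B\times C\subseteq ser$. A step sequence $u=A_1\dots A_k$ is in GMC-form iff for each $i=1,\dots,k$ and all $B\in\mathbb{S}$, $y\in\mathbb{S}^*$: $By\equiv A_i\dots A_k\Rightarrow|B|\le|A_i|$. The forward dependency $\mathbb{FD}\subseteq\mathbb{S}\times\mathbb{S}$ consists of pairs $(A,B)$ for which there is $C\in\mathbb{S}$ with $C\subseteq B$, $A\times C\subseteq ser$ and $C\times(B\setminus C)\subseteq ser$. A step sequence $A_1\dots A_k$ is canonical iff $(A_i,A_{i+1})\notin\mathbb{FD}$ for all $1\le i<k$. *)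

theory Defs
  imports Main
begin

locale comtrace_alphabet =
  fixes E :: "'a set" and sim :: "'a rel" and ser :: "'a rel"
  assumes finite_E: "finite E"
    and sim_subset: "sim \<subseteq> E \<times> E"
    and irrefl_sim: "irrefl sim"
    and sym_sim: "sym sim"
    and ser_subset: "ser \<subseteq> sim"

definition steps :: "'a set \<Rightarrow> 'a rel \<Rightarrow> 'a set set" where
  "steps E sim = {A. A \<noteq> {} \<and> A \<subseteq> E \<and> (\<forall>a\<in>A. \<forall>b\<in>A. a \<noteq> b \<longrightarrow> (a, b) \<in> sim)}"

abbreviation step_seqs :: "'a set \<Rightarrow> 'a rel \<Rightarrow> 'a set list set" where
  "step_seqs E sim \<equiv> lists (steps E sim)"

inductive comtrace_split ::
    "'a set \<Rightarrow> 'a rel \<Rightarrow> 'a rel \<Rightarrow> 'a set list \<Rightarrow> 'a set list \<Rightarrow> bool"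
  for E sim ser where
  "\<lbrakk>w \<in> step_seqs E sim; z \<in> step_seqs E sim;
    A \<in> steps E sim; B \<in> steps E sim; C \<in> steps E sim;
    A = B \<union> C; B \<times> C \<subseteq> ser\<rbrakk>
   \<Longrightarrow> comtrace_split E sim ser (w @ [A] @ z) (w @ [B, C] @ z)"

text \<open>The closure is taken on all lists of sets. Since both sides of every generating pair are step
  sequences, a list that is not a step sequence is related only to itself, so on step sequences this
  is the reflexive, symmetric and transitive closure.\<close>

definition comtrace_cong ::
    "'a set \<Rightarrow> 'a rel \<Rightarrow> 'a rel \<Rightarrow> 'a set list \<Rightarrow> 'a set list \<Rightarrow> bool" where
  "comtrace_cong E sim ser = equivclp (comtrace_split E sim ser)"

definition GMC_form :: "'a set \<Rightarrow> 'a rel \<Rightarrow> 'a rel \<Rightarrow> 'a set list \<Rightarrow> bool" where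
  "GMC_form E sim ser u \<longleftrightarrow>
    (\<forall>i<length u. \<forall>B\<in>steps E sim. \<forall>y\<in>step_seqs E sim.
      comtrace_cong E sim ser (B # y) (drop i u) \<longrightarrow> card B \<le> card (u ! i))"

definition forward_dep :: "'a set \<Rightarrow> 'a rel \<Rightarrow> 'a rel \<Rightarrow> ('a set \<times> 'a set) set" where
  "forward_dep E sim ser =
    {(A, B). A \<in> steps E sim \<and> B \<in> steps E sim \<and>
      (\<exists>C\<in>steps E sim. C \<subseteq> B \<and> A \<times> C \<subseteq> ser \<and> C \<times> (B - C) \<subseteq> ser)}"

definition canonical :: "'a set \<Rightarrow> 'a rel \<Rightarrow> 'a rel \<Rightarrow> 'a set list \<Rightarrow> bool" where
  "canonical E sim ser u \<longleftrightarrow>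
    (\<forall>i. Suc i < length u \<longrightarrow> (u ! i, u ! Suc i) \<notin> forward_dep E sim ser)"

end

theory Submission
  imports Defs
begin

text \<open>A pair in the forward dependency lets a set \<open>C\<close> move from a step to the preceding one,
  which makes that step larger; so GMC-form implies canonical form.

  Conversely, let \<open>u\<close> be canonical with first step \<open>A\<close>, and let \<open>B y \<equiv> u\<close>. Then even
  \<open>B \<subseteq> A\<close>. Otherwise take a later step \<open>D\<close> of \<open>u\<close> containing the first occurrence of some element
  of \<open>B\<close>, and let \<open>C\<close> be the set of elements of \<open>B\<close> that first occur in \<open>D\<close>. In \<open>B y\<close> an element
  \<open>c\<close> of \<open>C\<close> occurs no later than any element of the step before \<open>D\<close>, and strictly earlier than the
  occurrences of the elements of \<open>D - C\<close> in \<open>D\<close>. A change of the relative order of two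
  occurrences is possible only through \<open>ser\<close>, so \<open>C\<close> witnesses a forward dependency in \<open>u\<close>.\<close>

text \<open>This count and \<open>count_until\<close> express the order of occurrences by numbers
  that can be compared along the congruence. They differ in whether the step with the first
  \<open>c\<close> still counts, which separates "strictly before" from "not after".\<close>

primrec count_before :: "'a \<Rightarrow> 'a \<Rightarrow> 'a set list \<Rightarrow> nat" where
  "count_before a c [] = 0"
| "count_before a c (A # u) = (if c \<in> A then 0 else of_bool (a \<in> A) + count_before a c u)"

primrec count_until :: "'a \<Rightarrow> 'a \<Rightarrow> 'a set list \<Rightarrow> nat" where
  "count_until a c [] = 0"
| "count_until a c (A # u) = of_bool (a \<in> A) + (if c \<in> A then 0 else count_until a c u)"

lemma count_before_append:
  "c \<notin> \<Union>(set u) \<Longrightarrow>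
    count_before a c (u @ v) = length (filter (\<lambda>A. a \<in> A) u) + count_before a c v"
  by (induction u) auto

lemma count_until_append:
  "c \<notin> \<Union>(set u) \<Longrightarrow>
    count_until a c (u @ v) = length (filter (\<lambda>A. a \<in> A) u) + count_until a c v"
  by (induction u) auto

text \<open>With equal letters the count only tests occurrence, so its invariance shows that
  congruent sequences have the same letters.\<close>

lemma count_until_self: "count_until c c u = of_bool (c \<in> \<Union>(set u))"
  by (induction u) auto

lemma equivclp_invariant:
  assumes "equivclp R x y" "\<And>x y. R x y \<Longrightarrow> f x = f y"
  shows "f x = f y"
  using assms(1) by (induction rule: equivclp_induct) (auto dest: assms(2))

lemma comtrace_cong_sym:
  "comtrace_cong E sim ser u v \<Longrightarrow> comtrace_cong E sim ser v u"
  unfolding comtrace_cong_def by (rule equivclp_sym)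

lemma comtrace_cong_trans:
  "comtrace_cong E sim ser u v \<Longrightarrow> comtrace_cong E sim ser v w \<Longrightarrow> comtrace_cong E sim ser u w"
  unfolding comtrace_cong_def by (rule equivclp_trans)

lemma comtrace_cong_split:
  assumes "w \<in> step_seqs E sim" "z \<in> step_seqs E sim" "B \<in> steps E sim" "C \<in> steps E sim"
    "B \<union> C \<in> steps E sim" "B \<times> C \<subseteq> ser"
  shows "comtrace_cong E sim ser (w @ [B \<union> C] @ z) (w @ [B, C] @ z)"
  unfolding comtrace_cong_def
  using assms by (intro r_into_equivclp comtrace_split.intros) auto

lemma steps_subset: "A \<in> steps E sim \<Longrightarrow> B \<subseteq> A \<Longrightarrow> B \<noteq> {} \<Longrightarrow> B \<in> steps E sim"
  unfolding steps_def by blast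

lemma canonical_drop: "canonical E sim ser u \<Longrightarrow> canonical E sim ser (drop i u)"
  unfolding canonical_def by auto

lemma canonical_append:
  "canonical E sim ser (u @ A # B # v) \<Longrightarrow> (A, B) \<notin> forward_dep E sim ser"
  unfolding canonical_def by (drule spec[of _ "length u"]) (simp add: nth_append)

context comtrace_alphabet
begin

lemma ser_irrefl: "(a, a) \<notin> ser"
  using ser_subset irrefl_sim by (auto simp: irrefl_def)

lemma finite_step: "A \<in> steps E sim \<Longrightarrow> finite A"
  using finite_E by (auto simp: steps_def intro: finite_subset)

lemma step_Un:
  assumes "A \<in> steps E sim" "B \<in> steps E sim" "A \<times> B \<subseteq> ser"
  shows "A \<union> B \<in> steps E sim"
proof -
  have "(a, b) \<in> sim" "(b, a) \<in> sim" if "a \<in> A" "b \<in> B" for a b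
    using that assms(3) ser_subset sym_sim by (auto dest: symD)
  then show ?thesis
    using assms(1,2) by (auto simp: steps_def)
qed

text \<open>Only an \<open>a\<close> in \<open>B\<close> with \<open>c\<close> in \<open>C\<close>
  could newly come before \<open>c\<close>, and \<open>B \<times> C \<subseteq> ser\<close> then
  gives the excluded pair. Irreflexivity makes \<open>B\<close> and \<open>C\<close> disjoint, so no
  letter is doubled.\<close>

lemma count_before_split:
  assumes "comtrace_split E sim ser u v" "(a, c) \<notin> ser"
  shows "count_before a c u = count_before a c v"
  using assms(1)
proof cases
  case (1 w z A B C)
  have "count_before a c ((B \<union> C) # z) = count_before a c (B # C # z)"
    using 1 assms(2) ser_irrefl by auto
  then show ?thesis
    unfolding 1 by (induction w) auto
qed

text \<open>Dually, an \<open>a\<close> is lost only if it lies in \<open>C\<close> while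
  \<open>c\<close> lies in \<open>B\<close>.\<close>

lemma count_until_split:
  assumes "comtrace_split E sim ser u v" "(c, a) \<notin> ser"
  shows "count_until a c u = count_until a c v"
  using assms(1)
proof cases
  case (1 w z A B C)
  have "count_until a c ((B \<union> C) # z) = count_until a c (B # C # z)"
    using 1 assms(2) ser_irrefl by auto
  then show ?thesis
    unfolding 1 by (induction w) auto
qed

lemma count_before_cong:
  "comtrace_cong E sim ser u v \<Longrightarrow> (a, c) \<notin> ser \<Longrightarrow> count_before a c u = count_before a c v"
  unfolding comtrace_cong_def by (erule equivclp_invariant) (rule count_before_split)

lemma count_until_cong:
  "comtrace_cong E sim ser u v \<Longrightarrow> (c, a) \<notin> ser \<Longrightarrow> count_until a c u = count_until a c v"
  unfolding comtrace_cong_def by (erule equivclp_invariant) (rule count_until_split)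

lemma canonical_first_step:
  assumes "canonical E sim ser (A # u)" and "A # u \<in> step_seqs E sim" and "B \<in> steps E sim"
    and "comtrace_cong E sim ser (B # y) (A # u)"
  shows "B \<subseteq> A"
proof (rule ccontr)
  assume "\<not> B \<subseteq> A"
  then obtain b where b: "b \<in> B" "b \<notin> A" by blast
  have "count_until b b (B # y) = count_until b b (A # u)"
    using assms(4) ser_irrefl by (rule count_until_cong)
  then have "\<exists>D\<in>set (A # u). b \<in> D"
    using b(1) unfolding count_until_self of_bool_eq_iff by simp
  then obtain us D vs where D: "A # u = us @ D # vs" "b \<in> D" "\<forall>D\<in>set us. b \<notin> D"
    using split_list_first_prop[of "A # u" "\<lambda>D. b \<in> D"] by metis
  with b(2) have "us \<noteq> []" by (cases us) auto
  then obtain p D' where us: "us = p @ [D']" by (metis rev_exhaust)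
  define C where "C = B \<inter> D - \<Union>(set us)"
  have "C \<in> steps E sim"
    using assms(3) by (rule steps_subset) (use b D(2,3) in \<open>auto simp: C_def\<close>)
  moreover have "D' \<times> C \<subseteq> ser"
  proof clarify
    fix a c assume ac: "a \<in> D'" "c \<in> C"
    \<comment> \<open>The first \<open>c\<close> is in \<open>B\<close> on one side; on the other it
      is in \<open>D\<close>, after \<open>D'\<close> has contributed an \<open>a\<close>.\<close>
    have "count_before a c (B # y) = 0" "count_before a c (A # u) > 0"
      using ac us unfolding D(1) by (auto simp: C_def count_before_append)
    then show "(a, c) \<in> ser"
      using count_before_cong[OF assms(4)] by fastforce
  qed
  moreover have "C \<times> (D - C) \<subseteq> ser"
  proof clarify
    fix c d assume cd: "c \<in> C" "d \<in> D" "d \<notin> C"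
    \<comment> \<open>Both counts stop at the first \<open>c\<close>, in \<open>B\<close> and in
      \<open>D\<close>. If \<open>d\<close> is not in \<open>B\<close>, they are 0 and at least 1.
      Otherwise \<open>d \<notin> C\<close> forces an earlier \<open>d\<close> in \<open>us\<close>,
      and they are 1 and at least 2.\<close>
    have "count_until d c (B # y) = of_bool (d \<in> B)"
      using cd by (simp add: C_def)
    moreover have "count_until d c (A # u) = Suc (length (filter (\<lambda>X. d \<in> X) us))"
      using cd unfolding D(1) by (subst count_until_append) (auto simp: C_def)
    moreover have "filter (\<lambda>X. d \<in> X) us \<noteq> []" if "d \<in> B"
      using that cd by (auto simp: C_def filter_empty_conv)
    ultimately have "count_until d c (B # y) \<noteq> count_until d c (A # u)"
      by (cases "d \<in> B") auto
    then show "(c, d) \<in> ser"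
      using count_until_cong[OF assms(4)] by blast
  qed
  moreover have "D' \<in> steps E sim" "D \<in> steps E sim" "C \<subseteq> D"
    using assms(2) unfolding D(1) us C_def by auto
  ultimately have "(D', D) \<in> forward_dep E sim ser"
    unfolding forward_dep_def by blast
  with assms(1) show False
    unfolding D(1) us using canonical_append[of E sim ser p D' D vs] by simp
qed

lemma forward_dep_larger_step:
  assumes "(A, D) \<in> forward_dep E sim ser" "z \<in> step_seqs E sim"
  obtains B y where "B \<in> steps E sim" "y \<in> step_seqs E sim"
    "comtrace_cong E sim ser (B # y) (A # D # z)" "card A < card B"
proof -
  obtain C where A: "A \<in> steps E sim" and D: "D \<in> steps E sim" and C: "C \<in> steps E sim"
    and sub: "C \<subseteq> D" and AC: "A \<times> C \<subseteq> ser" and CD: "C \<times> (D - C) \<subseteq> ser"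
    using assms(1) unfolding forward_dep_def by blast
  have AC_step: "A \<union> C \<in> steps E sim" using A C AC by (rule step_Un)
  \<comment> \<open>Disjointness makes the enlargement of \<open>A\<close> strict.\<close>
  have "A \<inter> C = {}" "C \<noteq> {}"
    using AC ser_irrefl C by (auto simp: steps_def)
  then have "card A < card (A \<union> C)"
    using A C finite_step by (intro psubset_card_mono) auto
  moreover have merge: "comtrace_cong E sim ser ((A \<union> C) # y) (A # C # y)"
    if "y \<in> step_seqs E sim" for y
    using comtrace_cong_split[of "[]" E sim y A C ser] that A C AC AC_step by simp
  moreover have "\<exists>y\<in>step_seqs E sim. comtrace_cong E sim ser ((A \<union> C) # y) (A # D # z)"
  \<comment> \<open>Steps are nonempty, so if nothing of \<open>D\<close> remains, the tail is
    \<open>z\<close> itself.\<close>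
  proof (cases "D = C")
    case True
    then show ?thesis using merge assms(2) by blast
  next
    case False
    then have DC: "D - C \<in> steps E sim" using D sub by (auto intro: steps_subset)
    have "C \<union> (D - C) = D" using sub by blast
    then have "comtrace_cong E sim ser (A # D # z) (A # C # (D - C) # z)"
      using comtrace_cong_split[of "[A]" E sim z C "D - C" ser] A C D DC CD assms(2) by simp
    moreover have "comtrace_cong E sim ser ((A \<union> C) # (D - C) # z) (A # C # (D - C) # z)"
      using DC assms(2) by (intro merge) simp
    ultimately have "comtrace_cong E sim ser ((A \<union> C) # (D - C) # z) (A # D # z)"
      by (metis comtrace_cong_trans comtrace_cong_sym)
    then show ?thesis using DC assms(2) by (intro bexI[of _ "(D - C) # z"]) auto
  qed
  ultimately show thesis using that AC_step by blast
qed

end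

theorem theorem8p2:
  fixes E :: "'a set" and sim ser :: "'a rel" and u :: "'a set list"
  assumes "comtrace_alphabet E sim ser"
    and "u \<in> step_seqs E sim"
  shows "GMC_form E sim ser u \<longleftrightarrow> canonical E sim ser u"
proof -
  interpret comtrace_alphabet E sim ser by fact
  have drop_steps: "drop i u \<in> step_seqs E sim" for i
    using assms(2) by (auto dest: in_set_dropD)
  show ?thesis
  proof
    assume gmc: "GMC_form E sim ser u"
    show "canonical E sim ser u"
      unfolding canonical_def
    proof (intro allI impI notI)
      fix i assume i: "Suc i < length u" and dep: "(u ! i, u ! Suc i) \<in> forward_dep E sim ser"
      have "drop i u = u ! i # u ! Suc i # drop (Suc (Suc i)) u"
        using i by (simp add: Cons_nth_drop_Suc)
      then obtain B y where "B \<in> steps E sim" "y \<in> step_seqs E sim"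
        "comtrace_cong E sim ser (B # y) (drop i u)" "card (u ! i) < card B"
        using forward_dep_larger_step[OF dep drop_steps] by metis
      with gmc i show False
        unfolding GMC_form_def by (meson Suc_lessD not_le)
    qed
  next
    assume can: "canonical E sim ser u"
    show "GMC_form E sim ser u"
      unfolding GMC_form_def
    proof (intro allI impI ballI)
      fix i B y
      assume i: "i < length u" and B: "B \<in> steps E sim"
        and cong: "comtrace_cong E sim ser (B # y) (drop i u)"
      have drop: "drop i u = u ! i # drop (Suc i) u"
        using i by (simp add: Cons_nth_drop_Suc)
      \<comment> \<open>Every suffix of a canonical sequence is canonical, so the result on first
        steps applies at each position.\<close>
      have "B \<subseteq> u ! i"
        using canonical_first_step B cong canonical_drop[OF can, of i] drop_steps[of i]
        unfolding drop by blast
      moreover have "finite (u ! i)"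
        using i assms(2) by (auto intro: finite_step)
      ultimately show "card B \<le> card (u ! i)" by (rule card_mono[rotated])
    qed
  qed
qed

end
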